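(* Let $P,Q\in\mathbb{H}^{n\times n}$ be nontrivial generalized reflection matrices, and let $U=[U_1,\ U_2]$ and $V=[V_1,\ V_2]$ be unitary matrices in $\mathbb{H}^{n\times n}$, with $U_1\in\mathbb{H}^{n\times r_1}$, $U_2\in\mathbb{H}^{n\times(n-r_1)}$, $V_1\in\mathbb{H}^{n\times r_2}$, $V_2\in\mathbb{H}^{n\times(n-r_2)}$, such that $$P=U\begin{bmatrix} I_{r_1}&0\\ 0&-I_{n-r_1}\end{bmatrix}U^*,\qquad Q=V\begin{bmatrix} I_{r_2}&0\\ 0&-I_{n-r_2}\end{bmatrix}V^*.$$ Let $Z\in\mathbb{H}^{n\times m}$ and $\Lambda=\mathrm{diag}(\lambda_1,\dots,\lambda_m)$, where $\lambda_1,\dots,\lambda_m$ are complex numbers with nonnegative imaginary parts. Let $0<k<m$ and suppose that $$Z=[V_1X_1,\ V_2X_2]=[U_1Y_1,\ U_2Y_2],\qquad \Lambda=\begin{bmatrix}\Phi&0\\ 0&\Psi\end{bmatrix},$$ where $X_1\in\mathbb{H}^{r_2\times k}$, $X_2\in\mathbb{H}^{(n-r_2)\times(m-k)}$, $Y_1\in\mathbb{H}^{r_1\times k}$, $Y_2\in\mathbb{H}^{(n-r_1)\times(m-k)}$, $\Phi=\mathrm{diag}(\lambda_1,\dots,\lambda_k)$, $\Psi=\mathrm{diag}(\lambda_{k+1},\dots,\lambda_m)$. Then the set $$\varphi_1(Z,\Lambda)=\{A\in\mathbb{H}_r^{n\times n}(P,Q)\ :\ AZ=Z\Lambda\}$$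 is nonempty if and only if $$Y_1\Phi X_1^{+}X_1=Y_1\Phi,\qquad Y_2\Psi X_2^{+}X_2=Y_2\Psi.$$ In that case, the general expression of $A\in\varphi_1(Z,\Lambda)$ is $$A=[U_1,\ U_2]\begin{bmatrix}Y_1\Phi X_1^{+}+W_1R_{X_1}&0\\ 0&Y_2\Psi X_2^{+}+W_2R_{X_2}\end{bmatrix}\begin{bmatrix}V_1^*\\ V_2^*\end{bmatrix},$$ where $W_1\in\mathbb{H}^{r_1\times r_2}$ and $W_2\in\mathbb{H}^{(n-r_1)\times(n-r_2)}$ are arbitrary.
   Context: $\mathbb{H}$ is the real quaternion algebra, $\mathbb{H}^{m\times n}$ the set of $m\times n$ matrices over $\mathbb{H}$, and $^*$ denotes conjugate transpose. A matrix $P\in\mathbb{H}^{n\times n}$ is a nontrivial generalized reflection matrix if $P^*=P\neq I$ and $P^2=I$. $\mathbb{H}_r^{n\times n}(P,Q)=\{A\in\mathbb{H}^{n\times n}: A=PAQ\}$ is the set of generalized reflexive matrices with respect to $(P,Q)$. For a matrix $X$, $X^{+}$ denotes an arbitrary but fixed reflexive inverse of $X$, i.e. a matrix with $XX^{+}X=X$ and $X^{+}XX^{+}=X^{+}$; and $R_X=I-XX^{+}$. "General expression" means that $\varphi_1(Z,\Lambda)$ is exactly the set of matrices of the displayed form as $W_1,W_2$ vary. *)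

theory Defs
  imports Complex_Main "Jordan_Normal_Form.Matrix"
begin

text \<open>\<open>Quat a b c d\<close> stands for \<open>a + b i + c j + d k\<close>.\<close>

datatype quat = Quat (qRe: real) (qIm1: real) (qIm2: real) (qIm3: real)

lemma quat_eq_iff:
  "x = y \<longleftrightarrow> qRe x = qRe y \<and> qIm1 x = qIm1 y \<and> qIm2 x = qIm2 y \<and> qIm3 x = qIm3 y"
  by (cases x; cases y) simp

instantiation quat :: real_div_algebra
begin

definition zero_quat_def: "0 = Quat 0 0 0 0"

definition one_quat_def: "1 = Quat 1 0 0 0"

definition plus_quat_def:
  "x + y = Quat (qRe x + qRe y) (qIm1 x + qIm1 y) (qIm2 x + qIm2 y) (qIm3 x + qIm3 y)"

definition minus_quat_def:
  "x - y = Quat (qRe x - qRe y) (qIm1 x - qIm1 y) (qIm2 x - qIm2 y) (qIm3 x - qIm3 y)"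

definition uminus_quat_def:
  "- x = Quat (- qRe x) (- qIm1 x) (- qIm2 x) (- qIm3 x)"

definition scaleR_quat_def:
  "scaleR r x = Quat (r * qRe x) (r * qIm1 x) (r * qIm2 x) (r * qIm3 x)"

definition times_quat_def:
  "x * y = Quat
     (qRe x * qRe y - qIm1 x * qIm1 y - qIm2 x * qIm2 y - qIm3 x * qIm3 y)
     (qRe x * qIm1 y + qIm1 x * qRe y + qIm2 x * qIm3 y - qIm3 x * qIm2 y)
     (qRe x * qIm2 y - qIm1 x * qIm3 y + qIm2 x * qRe y + qIm3 x * qIm1 y)
     (qRe x * qIm3 y + qIm1 x * qIm2 y - qIm2 x * qIm1 y + qIm3 x * qRe y)"

definition inverse_quat_def:
  "inverse x = (let s = (qRe x)\<^sup>2 + (qIm1 x)\<^sup>2 + (qIm2 x)\<^sup>2 + (qIm3 x)\<^sup>2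
     in Quat (qRe x / s) (- qIm1 x / s) (- qIm2 x / s) (- qIm3 x / s))"

definition divide_quat_def: "x div y = x * inverse (y :: quat)"

lemmas quat_defs = zero_quat_def one_quat_def plus_quat_def minus_quat_def uminus_quat_def
  scaleR_quat_def times_quat_def

instance
proof
  fix x y z :: quat and a b :: real
  show "(x * y) * z = x * (y * z)"
    by (simp add: quat_defs algebra_simps)
  show "(x + y) * z = x * z + y * z" "x * (y + z) = x * y + x * z"
    by (simp_all add: quat_defs algebra_simps)
  have s: "(qRe x)\<^sup>2 + (qIm1 x)\<^sup>2 + (qIm2 x)\<^sup>2 + (qIm3 x)\<^sup>2 \<noteq> 0" if "x \<noteq> 0"
  proof
    assume "(qRe x)\<^sup>2 + (qIm1 x)\<^sup>2 + (qIm2 x)\<^sup>2 + (qIm3 x)\<^sup>2 = 0"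
    then have "qRe x = 0 \<and> qIm1 x = 0 \<and> qIm2 x = 0 \<and> qIm3 x = 0"
      by (simp add: add_nonneg_eq_0_iff)
    with that show False by (simp add: quat_eq_iff zero_quat_def)
  qed
  show "inverse x * x = 1" "x * inverse x = 1" if "x \<noteq> 0"
    using s[OF that]
    by (simp_all add: one_quat_def times_quat_def inverse_quat_def Let_def power2_eq_square
      add_divide_distrib[symmetric] diff_divide_distrib[symmetric] algebra_simps)
qed (simp_all add: quat_defs inverse_quat_def divide_quat_def algebra_simps Let_def)

end

definition qcnj :: "quat \<Rightarrow> quat" where
  "qcnj x = Quat (qRe x) (- qIm1 x) (- qIm2 x) (- qIm3 x)"

text \<open>The embedding of the complex numbers as the subfield spanned by \<open>1\<close> and \<open>i\<close>.\<close>

definition quat_of_complex :: "complex \<Rightarrow> quat" where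
  "quat_of_complex z = Quat (Re z) (Im z) 0 0"

lemma quat_units:
  defines "i \<equiv> Quat 0 1 0 0" and "j \<equiv> Quat 0 0 1 0" and "k \<equiv> Quat 0 0 0 1"
  shows "i * i = -1" "j * j = -1" "k * k = -1" "i * j = k" "j * k = i" "k * i = j"
  unfolding i_def j_def k_def by (simp_all add: quat_defs)

lemma qcnj_mult: "qcnj (x * y) = qcnj y * qcnj x"
  by (simp add: qcnj_def times_quat_def)

lemma quat_of_complex_mult: "quat_of_complex (z * w) = quat_of_complex z * quat_of_complex w"
  by (simp add: quat_of_complex_def times_quat_def)

text \<open>Quaternion matrices are elements of \<open>carrier_mat\<close>, whose product \<open>*\<close> only needs a
  (possibly noncommutative) semiring of entries. The library's \<open>mat_adjoint\<close> is restricted to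
  commutative fields, so the conjugate transpose is defined here.\<close>

definition qadjoint :: "quat mat \<Rightarrow> quat mat" where
  "qadjoint A = map_mat qcnj (transpose_mat A)"

definition append_cols :: "'a :: zero mat \<Rightarrow> 'a mat \<Rightarrow> 'a mat" (infixr \<open>@\<^sub>c\<close> 65) where
  "A @\<^sub>c B = four_block_mat A B (0\<^sub>m 0 (dim_col A)) (0\<^sub>m 0 (dim_col B))"

definition qunitary :: "nat \<Rightarrow> quat mat \<Rightarrow> bool" where
  "qunitary n U \<longleftrightarrow>
     U \<in> carrier_mat n n \<and> qadjoint U * U = 1\<^sub>m n \<and> U * qadjoint U = 1\<^sub>m n"

definition nontrivial_gen_reflection :: "nat \<Rightarrow> quat mat \<Rightarrow> bool" where
  "nontrivial_gen_reflection n P \<longleftrightarrow>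
     P \<in> carrier_mat n n \<and> qadjoint P = P \<and> P \<noteq> 1\<^sub>m n \<and> P * P = 1\<^sub>m n"

definition gen_reflexive_mats :: "nat \<Rightarrow> quat mat \<Rightarrow> quat mat \<Rightarrow> quat mat set" where
  "gen_reflexive_mats n P Q = {A \<in> carrier_mat n n. A = P * A * Q}"

definition reflexive_inverse :: "quat mat \<Rightarrow> quat mat \<Rightarrow> bool" where
  "reflexive_inverse X G \<longleftrightarrow>
     G \<in> carrier_mat (dim_col X) (dim_row X) \<and> X * G * X = X \<and> G * X * G = G"

text \<open>\<open>R_compl X G\<close> is \<open>R\<^sub>X = I - X X\<^sup>+\<close>, where \<open>G\<close> is the chosen reflexive inverse \<open>X\<^sup>+\<close>.\<close>

definition R_compl :: "quat mat \<Rightarrow> quat mat \<Rightarrow> quat mat" where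
  "R_compl X G = 1\<^sub>m (dim_row X) - X * G"

definition phi1 :: "nat \<Rightarrow> quat mat \<Rightarrow> quat mat \<Rightarrow> quat mat \<Rightarrow> quat mat \<Rightarrow> quat mat set" where
  "phi1 n P Q Z L = {A \<in> gen_reflexive_mats n P Q. A * Z = Z * L}"

end

theory Submission
  imports Defs
begin

text \<open>In the coordinates \<open>B = U\<^sup>* A V\<close> the condition \<open>A = P A Q\<close> says that \<open>B = J B K\<close> for the
  \<open>\<plusminus>1\<close> signature matrices \<open>J\<close>, \<open>K\<close> of the two reflections, i.e. that \<open>B = diag(B\<^sub>1, B\<^sub>2)\<close>. Since \<open>V\<^sup>* Z = diag(X\<^sub>1, X\<^sub>2)\<close> and
  \<open>U\<^sup>* Z = diag(Y\<^sub>1, Y\<^sub>2)\<close>, the equation \<open>A Z = Z \<Lambda>\<close> splits into \<open>B\<^sub>1 X\<^sub>1 = Y\<^sub>1 \<Phi>\<close> and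
  \<open>B\<^sub>2 X\<^sub>2 = Y\<^sub>2 \<Psi>\<close>, each of which is solved by means of a reflexive inverse.\<close>

section \<open>Solving \<open>B * X = C\<close> with a reflexive inverse of \<open>X\<close>\<close>

text \<open>Since \<open>X * G * X = X\<close>, right multiplication of \<open>C = B * X\<close> by
  \<open>G * X\<close> changes nothing. Splitting the identity as \<open>X * G\<close> plus
  \<open>R_compl X G\<close> decomposes \<open>B\<close>, so a solution serves as its own parameter
  in the general formula.\<close>

lemma reflexive_inverse_solution:
  assumes X: "X \<in> carrier_mat p k" and C: "C \<in> carrier_mat q k"
    and B: "B \<in> carrier_mat q p" and G: "reflexive_inverse X G" and eq: "B * X = C"
  shows "C * G * X = C" and "B = C * G + B * R_compl X G"
proof -
  have Gc: "G \<in> carrier_mat k p" and XGX: "X * G * X = X"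
    using G X by (auto simp: reflexive_inverse_def)
  have XG: "X * G \<in> carrier_mat p p"
    using X Gc by auto
  have BXG: "B * X * G = B * (X * G)"
    by (rule assoc_mult_mat[OF B X Gc])
  then have "C * G * X = B * (X * G * X)"
    using assoc_mult_mat[OF B XG X] by (simp add: eq)
  then show "C * G * X = C" by (simp add: XGX eq)
  have "B * R_compl X G = B - C * G"
    unfolding R_compl_def using B X XG BXG
    by (simp add: mult_minus_distrib_mat[of _ q p _ p] eq)
  then show "B = C * G + B * R_compl X G"
    using B C Gc by (auto intro!: eq_matI)
qed

text \<open>\<open>R_compl X G * X = X - X * G * X = 0\<close>, so the term with \<open>W\<close>
  vanishes after right multiplication by \<open>X\<close>, and the solvability condition settles the
  rest.\<close>

lemma reflexive_inverse_family:
  assumes X: "X \<in> carrier_mat p k" and C: "C \<in> carrier_mat q k"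
    and W: "W \<in> carrier_mat q p" and G: "reflexive_inverse X G" and CGX: "C * G * X = C"
  shows "C * G + W * R_compl X G \<in> carrier_mat q p"
    and "(C * G + W * R_compl X G) * X = C"
proof -
  have Gc: "G \<in> carrier_mat k p" and XGX: "X * G * X = X"
    using G X by (auto simp: reflexive_inverse_def)
  have R: "R_compl X G \<in> carrier_mat p p"
    using X Gc by (auto simp: R_compl_def)
  have RX: "R_compl X G * X = 0\<^sub>m p k"
    unfolding R_compl_def using X Gc XGX
    by (subst minus_mult_distrib_mat[of _ p p _ _ k]) auto
  show "C * G + W * R_compl X G \<in> carrier_mat q p"
    using C Gc W R by auto
  have "(C * G + W * R_compl X G) * X = C * G * X + W * R_compl X G * X"
    using C Gc W R X by (intro add_mult_distrib_mat) auto
  also have "W * R_compl X G * X = 0\<^sub>m q k"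
    using W R X RX by simp
  finally show "(C * G + W * R_compl X G) * X = C"
    using C by (simp add: CGX)
qed

section \<open>Block matrices\<close>

lemma four_block_mat_eq_iff:
  assumes "A \<in> carrier_mat nr1 nc1" "B \<in> carrier_mat nr1 nc2"
    "C \<in> carrier_mat nr2 nc1" "D \<in> carrier_mat nr2 nc2"
    "A' \<in> carrier_mat nr1 nc1" "B' \<in> carrier_mat nr1 nc2"
    "C' \<in> carrier_mat nr2 nc1" "D' \<in> carrier_mat nr2 nc2"
  shows "four_block_mat A B C D = four_block_mat A' B' C' D'
    \<longleftrightarrow> A = A' \<and> B = B' \<and> C = C' \<and> D = D'"
proof
  assume eq: "four_block_mat A B C D = four_block_mat A' B' C' D'"
  have entry: "four_block_mat A B C D $$ (i, j) = four_block_mat A' B' C' D' $$ (i, j)" for i j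
    by (simp add: eq)
  have "A $$ (i, j) = A' $$ (i, j)" if "i < nr1" "j < nc1" for i j
    using entry[of i j] assms that by auto
  moreover have "B $$ (i, j) = B' $$ (i, j)" if "i < nr1" "j < nc2" for i j
    using entry[of i "nc1 + j"] assms that by auto
  moreover have "C $$ (i, j) = C' $$ (i, j)" if "i < nr2" "j < nc1" for i j
    using entry[of "nr1 + i" j] assms that by auto
  moreover have "D $$ (i, j) = D' $$ (i, j)" if "i < nr2" "j < nc2" for i j
    using entry[of "nr1 + i" "nc1 + j"] assms that by auto
  ultimately show "A = A' \<and> B = B' \<and> C = C' \<and> D = D'"
    using assms by (auto intro!: eq_matI)
qed simp

lemma mult_block_diag_mat:
  fixes A1 :: "'a :: semiring_0 mat"
  assumes "A1 \<in> carrier_mat nr1 n1" "D1 \<in> carrier_mat nr2 n2"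
    "A2 \<in> carrier_mat n1 nc1" "D2 \<in> carrier_mat n2 nc2"
  shows "four_block_mat A1 (0\<^sub>m nr1 n2) (0\<^sub>m nr2 n1) D1 * four_block_mat A2 (0\<^sub>m n1 nc2) (0\<^sub>m n2 nc1) D2
    = four_block_mat (A1 * A2) (0\<^sub>m nr1 nc2) (0\<^sub>m nr2 nc1) (D1 * D2)"
  using assms by (subst mult_four_block_mat[of _ nr1 n1 _ n2 _ nr2 _ _ nc1 _ nc2]) auto

text \<open>A row of two blocks is a four-block matrix whose lower blocks have 0 rows, so block
  multiplication applies. This turns \<open>Z = [V1 X1, V2 X2]\<close> into \<open>V\<close> times a
  block diagonal matrix, and likewise for \<open>U\<close>.\<close>

lemma append_cols_mult_block_diag:
  fixes A1 :: "'a :: semiring_0 mat"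
  assumes "A1 \<in> carrier_mat n a" "A2 \<in> carrier_mat n b"
    "X1 \<in> carrier_mat a c" "X2 \<in> carrier_mat b d"
  shows "(A1 @\<^sub>c A2) * four_block_mat X1 (0\<^sub>m a d) (0\<^sub>m b c) X2 = (A1 * X1) @\<^sub>c (A2 * X2)"
  using assms unfolding append_cols_def
  by (subst mult_four_block_mat[of _ n a _ b _ 0 _ _ c _ d]) auto

section \<open>Conjugate transposes and unitary changes of coordinates\<close>

lemma qadjoint_carrier [simp]: "A \<in> carrier_mat a b \<Longrightarrow> qadjoint A \<in> carrier_mat b a"
  by (auto simp: qadjoint_def)

lemma qadjoint_append_cols:
  assumes "A \<in> carrier_mat n a" "B \<in> carrier_mat n b"
  shows "qadjoint (A @\<^sub>c B) = qadjoint A @\<^sub>r qadjoint B"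
  using assms unfolding qadjoint_def append_cols_def append_rows_def
  by (intro eq_matI) auto

text \<open>The right-nested form lets the cancellation rewrite inside products that associativity
  has normalised to the right.\<close>

lemma qunitary_cancel_left:
  assumes U: "qunitary n U" and B: "B \<in> carrier_mat n c"
  shows "qadjoint U * (U * B) = B"
proof -
  have "qadjoint U * (U * B) = qadjoint U * U * B"
    using U B by (subst assoc_mult_mat[of _ n n _ n _ c]) (auto simp: qunitary_def)
  then show ?thesis using U B by (simp add: qunitary_def)
qed

lemma qunitary_cancel_left':
  assumes U: "qunitary n U" and B: "B \<in> carrier_mat n c"
  shows "U * (qadjoint U * B) = B"
proof -
  have "U * (qadjoint U * B) = U * qadjoint U * B"
    using U B by (subst assoc_mult_mat[of _ n n _ n _ c]) (auto simp: qunitary_def)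
  then show ?thesis using U B by (simp add: qunitary_def)
qed

text \<open>The maps from \<open>B\<close> to \<open>U * B * qadjoint V\<close> and from
  \<open>A\<close> to \<open>qadjoint U * A * V\<close> are mutually inverse, so passing to the new
  coordinates loses nothing.\<close>

lemma qunitary_sandwich_inverse:
  assumes U: "qunitary n U" and V: "qunitary n V" and A: "A \<in> carrier_mat n n"
  shows "U * (qadjoint U * A * V) * qadjoint V = A"
    and "qadjoint U * (U * A * qadjoint V) * V = A"
proof -
  have c: "U \<in> carrier_mat n n" "V \<in> carrier_mat n n"
    "qadjoint U \<in> carrier_mat n n" "qadjoint V \<in> carrier_mat n n"
    and VV: "V * qadjoint V = 1\<^sub>m n" "qadjoint V * V = 1\<^sub>m n"
    using U V by (auto simp: qunitary_def)
  have "U * (qadjoint U * A * V) * qadjoint V = U * (qadjoint U * (A * (V * qadjoint V)))"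
    using c A by (simp add: assoc_mult_mat[of _ n n _ n _ n] mult_carrier_mat[of _ n n _ n])
  then show "U * (qadjoint U * A * V) * qadjoint V = A"
    using A qunitary_cancel_left'[OF U A] by (simp add: VV)
  have "qadjoint U * (U * A * qadjoint V) * V = qadjoint U * (U * (A * (qadjoint V * V)))"
    using c A by (simp add: assoc_mult_mat[of _ n n _ n _ n] mult_carrier_mat[of _ n n _ n])
  then show "qadjoint U * (U * A * qadjoint V) * V = A"
    using A qunitary_cancel_left[OF U A] by (simp add: VV)
qed

section \<open>Generalized reflexive matrices as block diagonal matrices\<close>

text \<open>In \<open>P * A * Q\<close> the inner factors \<open>qadjoint U * U\<close> and
  \<open>qadjoint V * V\<close> cancel, so the map from \<open>A\<close> to \<open>P * A * Q\<close>
  becomes the map from \<open>B\<close> to \<open>J * B * K\<close>.\<close>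

lemma gen_reflexive_sandwich_iff:
  assumes U: "qunitary n U" and V: "qunitary n V"
    and c: "J \<in> carrier_mat n n" "K \<in> carrier_mat n n" "B \<in> carrier_mat n n"
  shows "U * B * qadjoint V \<in> gen_reflexive_mats n (U * J * qadjoint U) (V * K * qadjoint V)
    \<longleftrightarrow> B = J * B * K"
proof -
  have uv: "U \<in> carrier_mat n n" "V \<in> carrier_mat n n"
    "qadjoint U \<in> carrier_mat n n" "qadjoint V \<in> carrier_mat n n"
    using U V by (auto simp: qunitary_def)
  have "U * J * qadjoint U * (U * B * qadjoint V) * (V * K * qadjoint V)
      = U * (J * (qadjoint U * (U * (B * (qadjoint V * (V * (K * qadjoint V)))))))"
    using c uv by (simp add: assoc_mult_mat[of _ n n _ n _ n] mult_carrier_mat[of _ n n _ n])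
  also have "\<dots> = U * (J * B * K) * qadjoint V"
    using c uv
    by (simp add: qunitary_cancel_left[OF V, of _ n] qunitary_cancel_left[OF U, of _ n]
      assoc_mult_mat[of _ n n _ n _ n] mult_carrier_mat[of _ n n _ n])
  finally have PAQ: "U * J * qadjoint U * (U * B * qadjoint V) * (V * K * qadjoint V)
    = U * (J * B * K) * qadjoint V" .
  have JBK: "J * B * K \<in> carrier_mat n n" using c by auto
  \<comment> \<open>The sandwich by \<open>U\<close> and \<open>qadjoint V\<close> is injective:
    both sides are sent back by its inverse.\<close>
  have "U * B * qadjoint V = U * (J * B * K) * qadjoint V \<longleftrightarrow> B = J * B * K"
    using qunitary_sandwich_inverse(2)[OF U V c(3)] qunitary_sandwich_inverse(2)[OF U V JBK]
    by metis
  moreover have "U * B * qadjoint V \<in> carrier_mat n n"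
    using uv c by (intro mult_carrier_mat[of _ n n])
  ultimately show ?thesis
    by (simp only: gen_reflexive_mats_def mem_Collect_eq PAQ simp_thms)
qed

text \<open>An entry equal to its negative has double 0; the real scalars allow division by
  2.\<close>

lemma mat_eq_uminus_iff:
  fixes B :: "'a :: real_vector mat"
  assumes "B \<in> carrier_mat a b"
  shows "B = - B \<longleftrightarrow> B = 0\<^sub>m a b"
proof
  assume eq: "B = - B"
  have "B $$ (i, j) = 0" if "i < a" "j < b" for i j
  proof -
    have "B $$ (i, j) = - B $$ (i, j)"
      using arg_cong[OF eq, of "\<lambda>M. M $$ (i, j)"] assms that by simp
    then have "2 *\<^sub>R B $$ (i, j) = 0"
      by (metis add.right_inverse scaleR_2)
    then show ?thesis by simp
  qed
  then show "B = 0\<^sub>m a b" using assms by (auto intro!: eq_matI)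
qed (auto intro!: eq_matI)

text \<open>The left factor negates the lower blocks and the right factor the right-hand blocks. The
  diagonal blocks are thus restored or untouched, while each off-diagonal block changes sign once
  and must equal its own negative.\<close>

lemma signature_invariant_iff:
  fixes B1 :: "'a :: real_algebra_1 mat"
  assumes c: "B1 \<in> carrier_mat a c" "B12 \<in> carrier_mat a d"
    "B21 \<in> carrier_mat b c" "B2 \<in> carrier_mat b d"
  shows "four_block_mat B1 B12 B21 B2
      = four_block_mat (1\<^sub>m a) (0\<^sub>m a b) (0\<^sub>m b a) (- 1\<^sub>m b) * four_block_mat B1 B12 B21 B2
        * four_block_mat (1\<^sub>m c) (0\<^sub>m c d) (0\<^sub>m d c) (- 1\<^sub>m d)
    \<longleftrightarrow> B12 = 0\<^sub>m a d \<and> B21 = 0\<^sub>m b c"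
proof -
  have "four_block_mat (1\<^sub>m a) (0\<^sub>m a b) (0\<^sub>m b a) (- 1\<^sub>m b) * four_block_mat B1 B12 B21 B2
      = four_block_mat B1 B12 (- B21) (- B2)"
    using c by (subst mult_four_block_mat[of _ a a _ b _ b _ _ c _ d]) auto
  moreover have "four_block_mat B1 B12 (- B21) (- B2)
        * four_block_mat (1\<^sub>m c) (0\<^sub>m c d) (0\<^sub>m d c) (- 1\<^sub>m d)
      = four_block_mat B1 (- B12) (- B21) B2"
    using c by (subst mult_four_block_mat[of _ a c _ d _ b _ _ c _ d]) auto
  ultimately show ?thesis
    using c four_block_mat_eq_iff[of B1 a c B12 d B21 b B2 B1 "- B12" "- B21" B2]
      mat_eq_uminus_iff[OF c(2)] mat_eq_uminus_iff[OF c(3)]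
    by auto
qed

text \<open>The size is written both as \<open>r + s\<close> and as \<open>r' + s'\<close> because
  the rows of \<open>B\<close> are partitioned according to \<open>U\<close> and its columns
  according to \<open>V\<close>; the diagonal blocks need not be square.\<close>

lemma gen_reflexive_mats_eq:
  assumes U: "qunitary (r + s) U" and V: "qunitary (r + s) V" and n: "r + s = r' + s'"
  shows "gen_reflexive_mats (r + s)
      (U * four_block_mat (1\<^sub>m r) (0\<^sub>m r s) (0\<^sub>m s r) (- 1\<^sub>m s) * qadjoint U)
      (V * four_block_mat (1\<^sub>m r') (0\<^sub>m r' s') (0\<^sub>m s' r') (- 1\<^sub>m s') * qadjoint V)
    = {U * four_block_mat B1 (0\<^sub>m r s') (0\<^sub>m s r') B2 * qadjoint V
      | B1 B2. B1 \<in> carrier_mat r r' \<and> B2 \<in> carrier_mat s s'}" (is "?L = ?R")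
proof -
  let ?J = "four_block_mat (1\<^sub>m r) (0\<^sub>m r s) (0\<^sub>m s r) (- 1\<^sub>m s) :: quat mat"
  let ?K = "four_block_mat (1\<^sub>m r') (0\<^sub>m r' s') (0\<^sub>m s' r') (- 1\<^sub>m s') :: quat mat"
  have J: "?J \<in> carrier_mat (r + s) (r + s)" by (intro four_block_carrier_mat) auto
  have K: "?K \<in> carrier_mat (r + s) (r + s)" unfolding n by (intro four_block_carrier_mat) auto
  note iff = gen_reflexive_sandwich_iff[OF U V J K]
  show ?thesis
  proof (intro equalityI subsetI)
    fix A assume A: "A \<in> ?L"
    then have Ac: "A \<in> carrier_mat (r + s) (r + s)" by (simp add: gen_reflexive_mats_def)
    define B where "B = qadjoint U * A * V"
    have Bc: "B \<in> carrier_mat (r + s) (r + s)"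
      using U V Ac unfolding B_def qunitary_def
      by (intro mult_carrier_mat[of _ "r + s" "r + s"]) auto
    have AB: "A = U * B * qadjoint V"
      unfolding B_def by (simp only: qunitary_sandwich_inverse(1)[OF U V Ac])
    \<comment> \<open>The cut is after row \<open>r\<close> (from \<open>U\<close>) and after column
      \<open>r'\<close> (from \<open>V\<close>).\<close>
    obtain B1 B12 B21 B2 where sp: "split_block B r r' = (B1, B12, B21, B2)"
      by (metis prod_cases4)
    have dims: "dim_row B = r + s" "dim_col B = r' + s'" using Bc n by auto
    note b = split_block[OF sp dims]
    have "B = ?J * B * ?K" using A iff[OF Bc] by (simp add: AB)
    then have "B12 = 0\<^sub>m r s'" "B21 = 0\<^sub>m s r'"
      using signature_invariant_iff[OF b(1-4)] unfolding b(5) by auto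
    then show "A \<in> ?R" using AB b by auto
  next
    fix A assume "A \<in> ?R"
    then obtain B1 B2 where b: "B1 \<in> carrier_mat r r'" "B2 \<in> carrier_mat s s'"
      and A: "A = U * four_block_mat B1 (0\<^sub>m r s') (0\<^sub>m s r') B2 * qadjoint V"
      by auto
    let ?B = "four_block_mat B1 (0\<^sub>m r s') (0\<^sub>m s r') B2"
    have Bc: "?B \<in> carrier_mat (r + s) (r + s)"
      using b four_block_carrier_mat[OF b] n by simp
    have "?B = ?J * ?B * ?K"
      using signature_invariant_iff[OF b(1) _ _ b(2), of "0\<^sub>m r s'" "0\<^sub>m s r'"] by auto
    then show "A \<in> ?L" using iff[OF Bc] by (simp add: A)
  qed
qed

section \<open>Splitting \<open>A * Z = Z * L\<close> into two independent equations\<close>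

text \<open>The two factorizations of \<open>Z\<close> are used on different sides: the one through
  \<open>V\<close> cancels \<open>qadjoint V\<close> in \<open>A * Z\<close>, the one through
  \<open>U\<close> puts \<open>U\<close> in front of \<open>Z * L\<close>. Both sides then start
  with \<open>U\<close>, which cancels and leaves block diagonal matrices to compare.\<close>

lemma eigen_equation_block_iff:
  assumes U: "qunitary n U" and V: "qunitary n V"
    and n: "r + s = n" "r' + s' = n"
    and X: "X1 \<in> carrier_mat r' k" "X2 \<in> carrier_mat s' l"
    and Y: "Y1 \<in> carrier_mat r k" "Y2 \<in> carrier_mat s l"
    and L: "Phi \<in> carrier_mat k k" "Psi \<in> carrier_mat l l"
    and ZX: "Z = V * four_block_mat X1 (0\<^sub>m r' l) (0\<^sub>m s' k) X2"
    and ZY: "Z = U * four_block_mat Y1 (0\<^sub>m r l) (0\<^sub>m s k) Y2"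
    and B: "B1 \<in> carrier_mat r r'" "B2 \<in> carrier_mat s s'"
  shows "U * four_block_mat B1 (0\<^sub>m r s') (0\<^sub>m s r') B2 * qadjoint V * Z
      = Z * four_block_mat Phi (0\<^sub>m k l) (0\<^sub>m l k) Psi
    \<longleftrightarrow> B1 * X1 = Y1 * Phi \<and> B2 * X2 = Y2 * Psi"
proof -
  let ?B = "four_block_mat B1 (0\<^sub>m r s') (0\<^sub>m s r') B2"
  let ?X = "four_block_mat X1 (0\<^sub>m r' l) (0\<^sub>m s' k) X2"
  let ?Y = "four_block_mat Y1 (0\<^sub>m r l) (0\<^sub>m s k) Y2"
  let ?L = "four_block_mat Phi (0\<^sub>m k l) (0\<^sub>m l k) Psi"
  have c: "?B \<in> carrier_mat n n" "?X \<in> carrier_mat n (k + l)" "?Y \<in> carrier_mat n (k + l)"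
    "?L \<in> carrier_mat (k + l) (k + l)"
    using four_block_carrier_mat[OF B] four_block_carrier_mat[OF X]
      four_block_carrier_mat[OF Y] four_block_carrier_mat[OF L] n by simp_all
  have uv: "U \<in> carrier_mat n n" "V \<in> carrier_mat n n"
    "qadjoint U \<in> carrier_mat n n" "qadjoint V \<in> carrier_mat n n"
    using U V by (auto simp: qunitary_def)
  have "U * ?B * qadjoint V * Z = U * (?B * (qadjoint V * (V * ?X)))"
    unfolding ZX using c uv by (simp add: assoc_mult_mat[of _ n n _ n _ "k + l"]
        assoc_mult_mat[of _ n n _ n _ n] mult_carrier_mat[of _ n n])
  also have "\<dots> = U * (?B * ?X)"
    by (simp add: qunitary_cancel_left[OF V c(2)])
  also have "?B * ?X = four_block_mat (B1 * X1) (0\<^sub>m r l) (0\<^sub>m s k) (B2 * X2)"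
    by (rule mult_block_diag_mat[OF B X])
  finally have l: "U * ?B * qadjoint V * Z
    = U * four_block_mat (B1 * X1) (0\<^sub>m r l) (0\<^sub>m s k) (B2 * X2)" .
  have "Z * ?L = U * (?Y * ?L)"
    unfolding ZY by (rule assoc_mult_mat[OF uv(1) c(3,4)])
  also have "?Y * ?L = four_block_mat (Y1 * Phi) (0\<^sub>m r l) (0\<^sub>m s k) (Y2 * Psi)"
    by (rule mult_block_diag_mat[OF Y L])
  finally have r: "Z * ?L = U * four_block_mat (Y1 * Phi) (0\<^sub>m r l) (0\<^sub>m s k) (Y2 * Psi)" .
  have bx: "B1 * X1 \<in> carrier_mat r k" "B2 * X2 \<in> carrier_mat s l"
    and yl: "Y1 * Phi \<in> carrier_mat r k" "Y2 * Psi \<in> carrier_mat s l"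
    using B X Y L by auto
  \<comment> \<open>Left multiplication by \<open>U\<close> is injective, with left inverse
    \<open>qadjoint U\<close>.\<close>
  have "U * four_block_mat (B1 * X1) (0\<^sub>m r l) (0\<^sub>m s k) (B2 * X2)
      = U * four_block_mat (Y1 * Phi) (0\<^sub>m r l) (0\<^sub>m s k) (Y2 * Psi)
    \<longleftrightarrow> four_block_mat (B1 * X1) (0\<^sub>m r l) (0\<^sub>m s k) (B2 * X2)
      = four_block_mat (Y1 * Phi) (0\<^sub>m r l) (0\<^sub>m s k) (Y2 * Psi)"
    using qunitary_cancel_left[OF U] four_block_carrier_mat[OF bx]
      four_block_carrier_mat[OF yl] n by metis
  then show ?thesis
    unfolding l r
    using four_block_mat_eq_iff[OF bx(1) _ _ bx(2) yl(1) _ _ yl(2)] by simp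
qed

section \<open>Solvability criterion and general solution\<close>

theorem theorem2p6:
  fixes n m k r1 r2 :: nat
    and P Q U V U1 U2 V1 V2 Z L Phi Psi X1 X2 Y1 Y2 X1p X2p :: "quat mat"
    and lam :: "nat \<Rightarrow> complex"
  assumes "nontrivial_gen_reflection n P" and "nontrivial_gen_reflection n Q"
    and "r1 \<le> n" and "r2 \<le> n"
    and "U1 \<in> carrier_mat n r1" and "U2 \<in> carrier_mat n (n - r1)"
    and "V1 \<in> carrier_mat n r2" and "V2 \<in> carrier_mat n (n - r2)"
    and "U = U1 @\<^sub>c U2" and "V = V1 @\<^sub>c V2"
    and "qunitary n U" and "qunitary n V"
    and "P = U * four_block_mat (1\<^sub>m r1) (0\<^sub>m r1 (n - r1))
                                (0\<^sub>m (n - r1) r1) (- 1\<^sub>m (n - r1)) * qadjoint U"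
    and "Q = V * four_block_mat (1\<^sub>m r2) (0\<^sub>m r2 (n - r2))
                                (0\<^sub>m (n - r2) r2) (- 1\<^sub>m (n - r2)) * qadjoint V"
    and "\<And>i. i < m \<Longrightarrow> Im (lam i) \<ge> 0"
    and "Z \<in> carrier_mat n m"
    and "L = mat_diag m (\<lambda>i. quat_of_complex (lam i))"
    and "0 < k" and "k < m"
    and "X1 \<in> carrier_mat r2 k" and "X2 \<in> carrier_mat (n - r2) (m - k)"
    and "Y1 \<in> carrier_mat r1 k" and "Y2 \<in> carrier_mat (n - r1) (m - k)"
    and "Z = (V1 * X1) @\<^sub>c (V2 * X2)" and "Z = (U1 * Y1) @\<^sub>c (U2 * Y2)"
    and "Phi = mat_diag k (\<lambda>i. quat_of_complex (lam i))"
    and "Psi = mat_diag (m - k) (\<lambda>i. quat_of_complex (lam (k + i)))"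
    and "L = four_block_mat Phi (0\<^sub>m k (m - k)) (0\<^sub>m (m - k) k) Psi"
    and "reflexive_inverse X1 X1p" and "reflexive_inverse X2 X2p"
  shows "(phi1 n P Q Z L \<noteq> {} \<longleftrightarrow>
            Y1 * Phi * X1p * X1 = Y1 * Phi \<and> Y2 * Psi * X2p * X2 = Y2 * Psi) \<and>
         (phi1 n P Q Z L \<noteq> {} \<longrightarrow>
            phi1 n P Q Z L =
              {(U1 @\<^sub>c U2)
                 * four_block_mat (Y1 * Phi * X1p + W1 * R_compl X1 X1p) (0\<^sub>m r1 (n - r2))
                                  (0\<^sub>m (n - r1) r2) (Y2 * Psi * X2p + W2 * R_compl X2 X2p)
                 * (qadjoint V1 @\<^sub>r qadjoint V2)
               | W1 W2. W1 \<in> carrier_mat r1 r2 \<and> W2 \<in> carrier_mat (n - r1) (n - r2)})"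
proof -
  note cU = assms(5,6) and cV = assms(7,8) and cX = assms(20,21) and cY = assms(22,23)
  have n1: "r1 + (n - r1) = n" and n2: "r2 + (n - r2) = n" using assms(3,4) by auto
  have Phi: "Phi \<in> carrier_mat k k" and Psi: "Psi \<in> carrier_mat (m - k) (m - k)"
    using assms(26,27) by auto
  have ZX: "Z = V * four_block_mat X1 (0\<^sub>m r2 (m - k)) (0\<^sub>m (n - r2) k) X2"
    using append_cols_mult_block_diag[OF cV cX] assms(10,24) by simp
  have ZY: "Z = U * four_block_mat Y1 (0\<^sub>m r1 (m - k)) (0\<^sub>m (n - r1) k) Y2"
    using append_cols_mult_block_diag[OF cU cY] assms(9,25) by simp
  have adjV: "qadjoint V = qadjoint V1 @\<^sub>r qadjoint V2"
    using qadjoint_append_cols[OF cV] assms(10) by simp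
  let ?A = "\<lambda>B1 B2. U * four_block_mat B1 (0\<^sub>m r1 (n - r2)) (0\<^sub>m (n - r1) r2) B2 * qadjoint V"
  have refl: "gen_reflexive_mats n P Q
      = {?A B1 B2 | B1 B2. B1 \<in> carrier_mat r1 r2 \<and> B2 \<in> carrier_mat (n - r1) (n - r2)}"
    using gen_reflexive_mats_eq[of r1 "n - r1" U V r2 "n - r2"] assms(11-14) n1 n2 by simp
  have eig: "?A B1 B2 * Z = Z * L \<longleftrightarrow> B1 * X1 = Y1 * Phi \<and> B2 * X2 = Y2 * Psi"
    if "B1 \<in> carrier_mat r1 r2" "B2 \<in> carrier_mat (n - r1) (n - r2)" for B1 B2
    unfolding assms(28)
    by (rule eigen_equation_block_iff[OF assms(11,12) n1 n2 cX cY Phi Psi ZX ZY that])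
  have phi: "phi1 n P Q Z L = {?A B1 B2 | B1 B2. B1 \<in> carrier_mat r1 r2
      \<and> B2 \<in> carrier_mat (n - r1) (n - r2) \<and> B1 * X1 = Y1 * Phi \<and> B2 * X2 = Y2 * Psi}"
    unfolding phi1_def refl using eig by blast
  have YL: "Y1 * Phi \<in> carrier_mat r1 k" "Y2 * Psi \<in> carrier_mat (n - r1) (m - k)"
    using cY Phi Psi by auto
  \<comment> \<open>Facts 1 and 3 of \<open>sol\<close> are the two solvability conditions; facts 2
    and 4 represent a given solution in parametric form.\<close>
  note sol = reflexive_inverse_solution[OF cX(1) YL(1) _ assms(29)]
    reflexive_inverse_solution[OF cX(2) YL(2) _ assms(30)]
  note fam = reflexive_inverse_family[OF cX(1) YL(1) _ assms(29)]
    reflexive_inverse_family[OF cX(2) YL(2) _ assms(30)]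
  let ?cond = "Y1 * Phi * X1p * X1 = Y1 * Phi \<and> Y2 * Psi * X2p * X2 = Y2 * Psi"
  let ?S = "{?A (Y1 * Phi * X1p + W1 * R_compl X1 X1p) (Y2 * Psi * X2p + W2 * R_compl X2 X2p)
    | W1 W2. W1 \<in> carrier_mat r1 r2 \<and> W2 \<in> carrier_mat (n - r1) (n - r2)}"
  have nec: ?cond if "phi1 n P Q Z L \<noteq> {}"
    using that sol(1,3) unfolding phi by blast
  have sub: "phi1 n P Q Z L \<subseteq> ?S"
  proof
    fix A assume "A \<in> phi1 n P Q Z L"
    then obtain B1 B2 where A: "A = ?A B1 B2" and B: "B1 \<in> carrier_mat r1 r2"
      "B2 \<in> carrier_mat (n - r1) (n - r2)" "B1 * X1 = Y1 * Phi" "B2 * X2 = Y2 * Psi"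
      unfolding phi by blast
    \<comment> \<open>The parameters are the diagonal blocks themselves: \<open>W1 = B1\<close> and
      \<open>W2 = B2\<close>.\<close>
    have "A = ?A (Y1 * Phi * X1p + B1 * R_compl X1 X1p) (Y2 * Psi * X2p + B2 * R_compl X2 X2p)"
      using A sol(2)[OF B(1,3)] sol(4)[OF B(2,4)] by simp
    then show "A \<in> ?S" using B by blast
  qed
  have sup: "?S \<subseteq> phi1 n P Q Z L" if ?cond
    unfolding phi using fam that by blast
  \<comment> \<open>Zero matrices are admissible parameters, so under \<open>?cond\<close> the
    inclusion of \<open>?S\<close> yields an actual solution.\<close>
  have "?S \<noteq> {}" using zero_carrier_mat by blast
  then have iff: "phi1 n P Q Z L \<noteq> {} \<longleftrightarrow> ?cond"
    using nec sup by blast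
  have "phi1 n P Q Z L = ?S" if "phi1 n P Q Z L \<noteq> {}"
    using sub sup[OF nec[OF that]] by (rule equalityI)
  then show ?thesis
    using iff unfolding adjV assms(9) by blast
qed

end
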